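(* Let $s\ge 2$ be an integer and let $d\ge 3$ be an odd integer. Then there exist integers $s'=s'(s,d)$ and $d'=d'(s,d)$ with $1\le d'\le d$ such that for every positive integer $n$, $$\nu_d(f_n(s,-1))=\delta_{d'\mathbb{Z}}(n)\,\nu_d\!\left(\frac{s'n}{d'}\right).$$
   Context: For integers $s,t$, the generalized Fibonacci sequence is $f_0(s,t)=0$, $f_1(s,t)=1$, $f_n(s,t)=s f_{n-1}(s,t)+t f_{n-2}(s,t)$ for $n\ge2$. If $d=p_1^{\alpha_1}\cdots p_k^{\alpha_k}$ is the prime factorization of $d$, then for a nonzero rational $q$, $\nu_d(q)=\min_{1\le i\le k}\lfloor \nu_{p_i}(q)/\alpha_i\rfloor$, where $\nu_{p_i}$ is the $p_i$-adic valuation; for a nonzero integer $N$ this is the largest $k$ with $d^k\mid N$. For a positive integer $d'$, $\delta_{d'\mathbb{Z}}(n)$ equals $1$ if $d'\mid n$ and $0$ otherwise. *)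

theory Defs
  imports Complex_Main "HOL-Computational_Algebra.Primes"
begin

fun gen_fib :: "int \<Rightarrow> int \<Rightarrow> nat \<Rightarrow> int" where
  "gen_fib s t 0 = 0"
| "gen_fib s t (Suc 0) = 1"
| "gen_fib s t (Suc (Suc n)) = s * gen_fib s t (Suc n) + t * gen_fib s t n"

text \<open>Only meaningful for prime \<open>p\<close> and \<open>q \<noteq> 0\<close>; the value at \<open>q = 0\<close> is the junk value 0.\<close>

definition padic_val :: "int \<Rightarrow> rat \<Rightarrow> int" where
  "padic_val p q =
     int (multiplicity p (fst (quotient_of q))) - int (multiplicity p (snd (quotient_of q)))"

text \<open>Only meaningful for \<open>d \<ge> 2\<close> and \<open>q \<noteq> 0\<close>.\<close>

definition nu :: "int \<Rightarrow> rat \<Rightarrow> int" where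
  "nu d q =
     Min ((\<lambda>p. \<lfloor>(of_int (padic_val p q) / of_nat (multiplicity p d) :: rat)\<rfloor>) ` prime_factors d)"

definition delta_mult :: "int \<Rightarrow> int \<Rightarrow> int" where
  "delta_mult m n = (if m dvd n then 1 else 0)"

lemma dvd_power_iff_le_nu:
  assumes "d \<ge> 2" and "N \<noteq> 0"
  shows "d ^ k dvd N \<longleftrightarrow> int k \<le> nu d (of_int N)"
proof -
  have ne: "prime_factors d \<noteq> {}"
    using assms(1) by (auto simp: prime_factorization_empty_iff)
  have pos: "multiplicity p d > 0" if "p \<in> prime_factors d" for p
    using that by (simp add: prime_factors_multiplicity)
  have pow: "multiplicity p (d ^ k) = k * multiplicity p d" if "prime p" for p
    using that assms(1) by (intro prime_elem_multiplicity_power_distrib) auto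
  have "int k \<le> nu d (of_int N) \<longleftrightarrow>
     (\<forall>p\<in>prime_factors d. of_nat k * of_nat (multiplicity p d) \<le> (of_nat (multiplicity p N) :: rat))"
    using ne pos
    by (simp add: nu_def padic_val_def le_floor_iff pos_le_divide_eq)
  also have "\<dots> \<longleftrightarrow> (\<forall>p\<in>prime_factors d. k * multiplicity p d \<le> multiplicity p N)"
    by (simp flip: of_nat_mult)
  also have "\<dots> \<longleftrightarrow> d ^ k dvd N"
  proof
    assume *: "\<forall>p\<in>prime_factors d. k * multiplicity p d \<le> multiplicity p N"
    show "d ^ k dvd N"
    proof (rule multiplicity_le_imp_dvd)
      fix p :: int assume p: "prime p"
      show "multiplicity p (d ^ k) \<le> multiplicity p N"
        using * p
        by (cases "p \<in> prime_factors d")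
           (auto simp: pow prime_factors_multiplicity)
    qed (use assms in auto)
  next
    assume "d ^ k dvd N"
    then have "multiplicity p (d ^ k) \<le> multiplicity p N" for p
      using assms(2) by (rule dvd_imp_multiplicity_le)
    then show "\<forall>p\<in>prime_factors d. k * multiplicity p d \<le> multiplicity p N"
      by (metis pow in_prime_factors_imp_prime)
  qed
  finally show ?thesis by simp
qed

end

theory Submission
  imports Defs "HOL-Number_Theory.Residues"
begin

text \<open>
  Write \<open>u n = f\<^sub>n(s,-1)\<close> and \<open>v k = u (k + 1) - u (k - 1)\<close>. Then \<open>u (k m) = u k \<cdot> f\<^sub>m(v k,-1)\<close> and
  \<open>(v k)\<^sup>2 - 4 = (s\<^sup>2 - 4) (u k)\<^sup>2\<close>. If an odd prime \<open>p\<close> divides \<open>u k\<close>, then \<open>v k\<close> is \<open>\<plusminus>2\<close> modulo \<open>p\<^sup>2\<close>,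
  so \<open>f\<^sub>m(v k,-1)\<close> is \<open>\<plusminus>m\<close> modulo \<open>p\<^sup>2\<close>; iterating over the factors \<open>p\<close> of \<open>m\<close>, it has the same \<open>p\<close>-adic
  valuation as \<open>m\<close>. Hence one can take for \<open>d'\<close> the least positive index with \<open>d dvd u d'\<close>, and
  \<open>s' = u d'\<close>.

  That \<open>d' \<le> d\<close> reduces to an odd prime \<open>d = p\<close>, because an index that works for \<open>e\<close>, multiplied by
  one that works for \<open>p\<close> (by \<open>p\<close> itself if \<open>p\<close> divides \<open>e\<close>), works for \<open>p e\<close>. If no \<open>u k\<close> with \<open>1 \<le> k \<le> p\<close> were divisible by \<open>p\<close>,
  the ratios \<open>u (n + 1) / u n\<close> for \<open>1 \<le> n \<le> p\<close> would be pairwise distinct modulo \<open>p\<close>, the last one being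
  zero; by Wilson's theorem \<open>u p\<close> is \<open>-1\<close> and \<open>u (p + 1)\<close> is \<open>0\<close> modulo \<open>p\<close>. The duplication formulas at
  \<open>(p \<plusminus> 1) / 2\<close> then give \<open>u p = 1\<close> modulo \<open>p\<close>, a contradiction.
\<close>

section \<open>Algebraic identities for the sequence and its companion\<close>

abbreviation lucas_u :: "int \<Rightarrow> nat \<Rightarrow> int" where
  "lucas_u s \<equiv> gen_fib s (- 1)"

text \<open>By the recurrence this is \<open>u (k + 1) - u (k - 1)\<close>, written without the
  index \<open>k - 1\<close> so that \<open>k = 0\<close> is covered.\<close>

definition lucas_v :: "int \<Rightarrow> nat \<Rightarrow> int" where
  "lucas_v s k = 2 * lucas_u s (Suc k) - s * lucas_u s k"

lemma lucas_u_add: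
  "lucas_u s (n + k) =
     lucas_u s n * lucas_u s (Suc k) + lucas_u s (Suc n) * lucas_u s k
       - s * lucas_u s n * lucas_u s k"
proof (induction n rule: induct_nat_012)
  case (ge2 n)
  have "lucas_u s (Suc (Suc n) + k) = s * lucas_u s (Suc n + k) - lucas_u s (n + k)"
    by simp
  then show ?case unfolding ge2.IH by (simp add: algebra_simps)
qed (simp_all add: algebra_simps)

lemma lucas_u_cassini:
  "(lucas_u s (Suc n))\<^sup>2 - s * lucas_u s (Suc n) * lucas_u s n + (lucas_u s n)\<^sup>2 = 1"
  by (induction n) (simp_all add: algebra_simps power2_eq_square)

lemma lucas_v_sq: "(lucas_v s k)\<^sup>2 - 4 = (s\<^sup>2 - 4) * (lucas_u s k)\<^sup>2"
  using lucas_u_cassini[of s k] by (simp add: lucas_v_def algebra_simps power2_eq_square)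

text \<open>Expansion by the addition formula leaves \<open>u n\<close> times Cassini's identity.
  With \<open>n = k * m\<close> this drives the induction for \<open>lucas_u_mult\<close>.\<close>

lemma lucas_u_add_double:
  "lucas_u s (n + k + k) = lucas_v s k * lucas_u s (n + k) - lucas_u s n"
proof -
  have Suc: "lucas_u s (Suc (n + k)) = lucas_u s (Suc n) * lucas_u s (Suc k) - lucas_u s n * lucas_u s k"
    using lucas_u_add[of s "Suc n" k] by (simp add: algebra_simps)
  have "lucas_u s n * ((lucas_u s (Suc k))\<^sup>2 - s * lucas_u s (Suc k) * lucas_u s k
      + (lucas_u s k)\<^sup>2) = lucas_u s n"
    by (simp add: lucas_u_cassini)
  then show ?thesis
    unfolding lucas_v_def lucas_u_add[of s "n + k" k] Suc lucas_u_add[of s n k]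
    by (simp add: algebra_simps power2_eq_square)
qed

lemma lucas_u_mult: "lucas_u s (k * m) = lucas_u s k * lucas_u (lucas_v s k) m"
proof (induction m rule: induct_nat_012)
  case (ge2 m)
  then show ?case
    using lucas_u_add_double[of s "k * m" k] by (simp add: algebra_simps)
qed simp_all

section \<open>Positivity and congruences\<close>

lemma lucas_u_pos_mono:
  assumes "s \<ge> 2"
  shows "0 \<le> lucas_u s n \<and> lucas_u s n < lucas_u s (Suc n)"
proof (induction n)
  case (Suc n)
  have "2 * lucas_u s (Suc n) \<le> s * lucas_u s (Suc n)"
    using Suc assms by (intro mult_right_mono) auto
  then show ?case using Suc unfolding gen_fib.simps by linarith
qed simp

lemma lucas_u_pos: "s \<ge> 2 \<Longrightarrow> n > 0 \<Longrightarrow> lucas_u s n > 0"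
  using lucas_u_pos_mono[of s "n - 1"] by (cases n) auto

lemma lucas_u_cong: "[s = t] (mod m) \<Longrightarrow> [lucas_u s n = lucas_u t n] (mod m)"
proof (induction n rule: induct_nat_012)
  case (ge2 n)
  then show ?case by (simp add: cong_diff cong_mult)
qed simp_all

lemma lucas_u_two: "lucas_u 2 n = int n"
  by (induction n rule: induct_nat_012) simp_all

lemma lucas_u_minus: "lucas_u (- s) n = (- 1) ^ Suc n * lucas_u s n"
  by (induction n rule: induct_nat_012) (simp_all add: algebra_simps)

lemma lucas_u_cong_pm:
  assumes "[V = 2] (mod q) \<or> [V = - 2] (mod q)"
  shows "[lucas_u V m = int m] (mod q) \<or> [lucas_u V m = - int m] (mod q)"
proof -
  have "lucas_u (- 2) m = int m \<or> lucas_u (- 2) m = - int m"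
    by (cases "even m") (simp_all add: lucas_u_minus[of 2] lucas_u_two)
  then show ?thesis
    using assms lucas_u_cong[of V 2 q m] lucas_u_cong[of V "- 2" q m] lucas_u_two[of m] by metis
qed

section \<open>Valuations at an odd prime\<close>

lemma odd_prime_not_dvd_two_power:
  fixes p :: int
  assumes "prime p" "odd p"
  shows "\<not> p dvd 2 ^ k"
proof
  assume "p dvd 2 ^ k"
  then have "p dvd 2" using assms by (metis prime_dvd_power)
  then have "p \<le> 2" by (intro zdvd_imp_le) auto
  then show False using assms prime_ge_2_int[of p] by auto
qed

text \<open>\<open>p\<close> cannot divide both \<open>V - 2\<close> and \<open>V + 2\<close>, whose
  difference is 4, so all of \<open>p ^ e\<close> goes into one factor.\<close>

lemma cong_pm2_if_sq:
  fixes p V :: int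
  assumes p: "prime p" "odd p" and V: "p ^ e dvd V\<^sup>2 - 4"
  shows "[V = 2] (mod p ^ e) \<or> [V = - 2] (mod p ^ e)"
proof -
  have eq: "V\<^sup>2 - 4 = (V - 2) * (V + 2)"
    by (simp add: algebra_simps power2_eq_square)
  have "\<not> (p dvd V - 2 \<and> p dvd V + 2)"
  proof
    assume "p dvd V - 2 \<and> p dvd V + 2"
    then have "p dvd (V + 2) - (V - 2)" using dvd_diff by blast
    then show False using odd_prime_not_dvd_two_power[OF p, of 2] by simp
  qed
  then have "coprime (p ^ e) (V - 2) \<or> coprime (p ^ e) (V + 2)"
    using p by (metis prime_imp_coprime coprime_power_left_iff)
  then show ?thesis
    using V unfolding eq cong_iff_dvd_diff
    by (auto simp: coprime_dvd_mult_left_iff coprime_dvd_mult_right_iff)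
qed

lemma multiplicity_lucas_u_eq:
  fixes p V :: int
  assumes p: "prime p" "odd p" and V: "p ^ 2 dvd V\<^sup>2 - 4" and "m > 0"
  shows "multiplicity p (lucas_u V m) = multiplicity p (int m) \<and> lucas_u V m \<noteq> 0"
  using V \<open>m > 0\<close>
proof (induction m arbitrary: V rule: less_induct)
  case (less m)
  have pm: "[lucas_u V k = int k] (mod p\<^sup>2) \<or> [lucas_u V k = - int k] (mod p\<^sup>2)" for k
    by (rule lucas_u_cong_pm[OF cong_pm2_if_sq[OF p less.prems(1)]])
  have dvd_iff: "q dvd lucas_u V k \<longleftrightarrow> q dvd int k" if "q dvd p\<^sup>2" for q k
    using pm[of k] cong_dvd_modulus[OF _ that] by (metis cong_dvd_iff dvd_minus_iff)
  show ?case
  proof (cases "p dvd int m")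
    case False
    then have "\<not> p dvd lucas_u V m"
      using dvd_iff[of p m] by simp
    with False show ?thesis by (auto simp: not_dvd_imp_multiplicity_0)
  next
    case True
    define P where "P = nat p"
    have P: "p = int P" "P > 1" using p prime_gt_1_int[of p] by (auto simp: P_def)
    from True obtain k where k: "m = P * k" using P by auto
    with less.prems P have k0: "k > 0" "k < m" by auto
    \<comment> \<open>The value is \<open>p\<close> or \<open>- p\<close> modulo
      \<open>p ^ 2\<close>, so \<open>p\<close> divides it exactly once; a congruence modulo
      \<open>p\<close> would not bound the exponent.\<close>
    have "p dvd lucas_u V P" "\<not> p\<^sup>2 dvd lucas_u V P"
      using P p by (auto simp: dvd_iff power2_eq_square dvd_mult_cancel_left)
    then have mP: "multiplicity p (lucas_u V P) = 1" "lucas_u V P \<noteq> 0"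
      by (auto intro!: multiplicity_eqI simp: power2_eq_square)
    \<comment> \<open>The induction goes on with \<open>lucas_v V P\<close> in place of
      \<open>V\<close> and \<open>k\<close> in place of \<open>m\<close>.\<close>
    have "p\<^sup>2 dvd (lucas_v V P)\<^sup>2 - 4"
      unfolding lucas_v_sq using \<open>p dvd lucas_u V P\<close> by (simp add: dvd_power_same)
    from less.IH[OF k0(2) this k0(1)] mP show ?thesis
      using k P p k0
      by (simp add: lucas_u_mult prime_elem_multiplicity_mult_distrib)
  qed
qed

lemma multiplicity_lucas_u_mult:
  fixes p s :: int
  assumes p: "prime p" "odd p" and "p dvd lucas_u s k" "lucas_u s k \<noteq> 0" "m > 0"
  shows "multiplicity p (lucas_u s (k * m)) = multiplicity p (lucas_u s k * int m)"
proof -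
  have "p\<^sup>2 dvd (lucas_v s k)\<^sup>2 - 4"
    unfolding lucas_v_sq using assms(3) by (simp add: dvd_power_same)
  from multiplicity_lucas_u_eq[OF p this \<open>m > 0\<close>] show ?thesis
    using assms by (auto simp: lucas_u_mult prime_elem_multiplicity_mult_distrib)
qed

section \<open>Indices at which \<open>d\<close> divides the sequence\<close>

lemma coprime_lucas_u_Suc:
  assumes "d dvd lucas_u s k"
  shows "coprime d (lucas_u s (Suc k))"
proof (rule coprimeI)
  fix c assume c: "c dvd d" "c dvd lucas_u s (Suc k)"
  with assms have "c dvd lucas_u s k" by auto
  with c(2) have "c dvd (lucas_u s (Suc k))\<^sup>2 - s * lucas_u s (Suc k) * lucas_u s k + (lucas_u s k)\<^sup>2"
    by (auto intro!: dvd_add dvd_diff simp: power2_eq_square)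
  then show "is_unit c" by (simp only: lucas_u_cassini)
qed

text \<open>Modulo \<open>d\<close> the addition formula leaves \<open>u n * u (k + 1)\<close>,
  whose second factor is a unit.\<close>

lemma dvd_lucas_u_add_iff:
  assumes "d dvd lucas_u s k"
  shows "d dvd lucas_u s (n + k) \<longleftrightarrow> d dvd lucas_u s n"
proof -
  have "lucas_u s (n + k) = lucas_u s n * lucas_u s (Suc k)
      + (lucas_u s (Suc n) - s * lucas_u s n) * lucas_u s k"
    by (simp add: lucas_u_add algebra_simps)
  then have "d dvd lucas_u s (n + k) \<longleftrightarrow> d dvd lucas_u s n * lucas_u s (Suc k)"
    using assms by (metis dvd_add_left_iff dvd_mult)
  then show ?thesis
    using coprime_lucas_u_Suc[OF assms] by (simp add: coprime_dvd_mult_left_iff)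
qed

lemma dvd_lucas_u_mod_iff:
  assumes "d dvd lucas_u s k"
  shows "d dvd lucas_u s n \<longleftrightarrow> d dvd lucas_u s (n mod k)"
proof -
  have "d dvd lucas_u s (r + q * k) \<longleftrightarrow> d dvd lucas_u s r" for r q
  proof (induction q)
    case (Suc q)
    then show ?case
      using dvd_lucas_u_add_iff[OF assms, of "r + q * k"] by (simp add: algebra_simps)
  qed simp
  from this[of "n mod k" "n div k"] show ?thesis by simp
qed

section \<open>An index at most \<open>d\<close>\<close>

lemma lucas_u_dOcagne:
  "lucas_u s (Suc m) * lucas_u s (m + k) - lucas_u s (Suc (m + k)) * lucas_u s m = lucas_u s k"
  by (induction m) (simp_all add: algebra_simps)

lemma exists_dvd_lucas_u_prime:
  fixes p :: nat
  assumes p: "prime p" "odd p"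
  shows "\<exists>k. 0 < k \<and> k \<le> p \<and> int p dvd lucas_u s k"
proof (rule ccontr)
  assume "\<not> ?thesis"
  then have nd: "\<not> int p dvd lucas_u s k" if "0 < k" "k \<le> p" for k
    using that by auto
  have p2: "p > 2" using p prime_ge_2_nat[of p] by (cases "p = 2") auto
  have pp: "prime (int p)" using p by simp
  have dvd_mult_iff: "int p dvd a * b \<longleftrightarrow> int p dvd a \<or> int p dvd b" for a b
    using pp by (simp add: prime_dvd_mult_iff)
  have "\<exists>r<p. [lucas_u s (Suc n) = int r * lucas_u s n] (mod int p)" if "n \<in> {1..p}" for n
  proof -
    have "coprime (lucas_u s n) (int p)"
      using that nd[of n] pp by (simp add: prime_imp_coprime coprime_commute)
    then obtain x where x: "[lucas_u s n * x = 1] (mod int p)"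
      using cong_solve_coprime_int by blast
    define r where "r = nat ((x * lucas_u s (Suc n)) mod int p)"
    have "int r = (x * lucas_u s (Suc n)) mod int p" "r < p"
      using p2 by (auto simp: r_def nat_less_iff)
    then have "[int r * lucas_u s n = (lucas_u s n * x) * lucas_u s (Suc n)] (mod int p)"
      by (simp add: cong_def mod_mult_left_eq mult.assoc mult.left_commute
          mult.commute[of "lucas_u s n"])
    also have "[(lucas_u s n * x) * lucas_u s (Suc n) = 1 * lucas_u s (Suc n)] (mod int p)"
      using x by (rule cong_mult) simp
    finally show ?thesis using \<open>r < p\<close> by (auto simp: cong_sym_eq)
  qed
  then obtain r where r: "\<And>n. n \<in> {1..p} \<Longrightarrow> r n < p"
      "\<And>n. n \<in> {1..p} \<Longrightarrow> [lucas_u s (Suc n) = int (r n) * lucas_u s n] (mod int p)"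
    by metis
  \<comment> \<open>Equal ratios at \<open>m\<close> and \<open>m + k\<close> make the left side of
    \<open>lucas_u_dOcagne\<close> vanish modulo \<open>p\<close>, but it equals
    \<open>u k\<close>.\<close>
  have neq: "r m \<noteq> r (m + k)" if "0 < m" "0 < k" "m + k \<le> p" for m k
  proof
    assume eq: "r m = r (m + k)"
    have "[lucas_u s (Suc m) * lucas_u s (m + k) - lucas_u s (Suc (m + k)) * lucas_u s m
        = (int (r m) * lucas_u s m) * lucas_u s (m + k)
          - (int (r (m + k)) * lucas_u s (m + k)) * lucas_u s m] (mod int p)"
      using that by (intro cong_diff cong_mult r(2)) auto
    then have "int p dvd lucas_u s k"
      unfolding lucas_u_dOcagne by (simp add: eq cong_0_iff)
    with nd[of k] that show False by auto
  qed
  have inj: "inj_on r {1..p}"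
  proof (rule linorder_inj_onI)
    fix x y assume "x < y" "x \<in> {1..p}" "y \<in> {1..p}"
    then show "r x \<noteq> r y" using neq[of x "y - x"] by auto
  qed auto
  have r0: "r n \<noteq> 0" if "n \<in> {1..<p}" for n
  proof
    assume "r n = 0"
    then have "int p dvd lucas_u s (Suc n)"
      using that r(2)[of n] by (simp add: cong_0_iff)
    then show False using that nd[of "Suc n"] by auto
  qed
  have sub: "r ` {1..<p} \<subseteq> {1..<p}"
    using r(1) r0 by (fastforce simp: Suc_le_eq)
  have inj': "inj_on r {1..<p}" using inj by (rule inj_on_subset) auto
  have img: "r ` {1..<p} = {1..<p}"
    using endo_inj_surj[OF _ sub inj'] by simp
  \<comment> \<open>The indices below \<open>p\<close> already use up all nonzero residues, so
    injectivity leaves only 0.\<close>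
  have "r p = 0"
  proof (rule ccontr)
    assume "r p \<noteq> 0"
    then have "r p \<in> r ` {1..<p}" unfolding img using r(1)[of p] p2 by auto
    then obtain i where "i \<in> {1..<p}" "r p = r i" by blast
    then show False using inj_onD[OF inj, of p i] p2 by auto
  qed
  then have fSp: "int p dvd lucas_u s (Suc p)"
    using r(2)[of p] p2 by (simp add: cong_0_iff)
  \<comment> \<open>The ratios telescope, starting from \<open>u 1 = 1\<close>.\<close>
  have "[lucas_u s (Suc n) = (\<Prod>i=1..<Suc n. int (r i))] (mod int p)" if "n < p" for n
    using that
  proof (induction n)
    case (Suc n)
    have "[lucas_u s (Suc (Suc n)) = int (r (Suc n)) * lucas_u s (Suc n)] (mod int p)"
      using Suc.prems by (intro r(2)) auto
    also have "[int (r (Suc n)) * lucas_u s (Suc n)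
        = int (r (Suc n)) * (\<Prod>i=1..<Suc n. int (r i))] (mod int p)"
      using Suc by (intro cong_mult) auto
    finally show ?case by (simp add: ac_simps)
  qed simp
  from this[of "p - 1"] have "[lucas_u s p = (\<Prod>i=1..<p. int (r i))] (mod int p)"
    using p2 by simp
  also have "(\<Prod>i=1..<p. int (r i)) = int (\<Prod>(r ` {1..<p}))"
    using prod.reindex[OF inj', of int] by simp
  also have "\<dots> = fact (p - 1)"
    unfolding img fact_prod using p2 by (simp add: atLeastLessThanSuc_atLeastAtMost[symmetric])
  also have "[fact (p - 1) = (- 1 :: int)] (mod int p)"
    using wilson_theorem[of p] p p2 by simp
  finally have fp: "int p dvd lucas_u s p + 1"
    by (simp add: cong_iff_dvd_diff)
  obtain j where j: "p = Suc (j + j)" using p by (auto elim!: oddE simp: mult_2)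
  define a b where "a = lucas_u s j" and "b = lucas_u s (Suc j)"
  have nb: "\<not> int p dvd b" using nd[of "Suc j"] j p2 by (simp add: b_def)
  have e1: "lucas_u s p = b\<^sup>2 - a\<^sup>2"
    using lucas_u_add[of s "Suc j" j]
    by (simp add: j a_def b_def power2_eq_square algebra_simps)
  have e2: "lucas_u s (Suc p) = b * (s * b - 2 * a)"
    using lucas_u_add[of s "Suc j" "Suc j"]
    by (simp add: j a_def b_def power2_eq_square algebra_simps)
  have cas: "b\<^sup>2 - s * b * a + a\<^sup>2 = 1"
    unfolding a_def b_def by (rule lucas_u_cassini)
  have d1: "int p dvd s * b - 2 * a" using fSp nb unfolding e2 dvd_mult_iff by simp
  \<comment> \<open>Since \<open>s * b\<close> is \<open>2 * a\<close> modulo \<open>p\<close>,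
    Cassini's identity turns \<open>u p\<close> into 1, against \<open>fp\<close>.\<close>
  have "(b\<^sup>2 - a\<^sup>2 + 1) - a * (s * b - 2 * a) = 2"
    using cas by (simp add: algebra_simps power2_eq_square)
  moreover have "int p dvd (b\<^sup>2 - a\<^sup>2 + 1) - a * (s * b - 2 * a)"
    using dvd_diff[OF fp[unfolded e1] dvd_mult[OF d1]] .
  ultimately have "int p dvd 2" by (simp only:)
  then show False
    using odd_prime_not_dvd_two_power[OF pp, of 1] p by simp
qed

lemma exists_dvd_lucas_u:
  fixes d :: nat
  assumes "odd d"
  shows "\<exists>k. 0 < k \<and> k \<le> d \<and> int d dvd lucas_u s k"
  using assms
proof (induction d rule: less_induct)
  case (less d)
  show ?case
  proof (cases "d = 1")
    case True
    then show ?thesis by (intro exI[of _ 1]) auto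
  next
    case False
    then obtain p where p: "prime p" "p dvd d" using prime_factor_nat by blast
    then obtain e where e: "d = p * e" by (elim dvdE)
    with less.prems p have oe: "odd p" "odd e" "e > 0" by (auto intro!: Nat.gr0I)
    then have "e < d" using e p prime_gt_1_nat[of p] by simp
    from less.IH[OF this oe(2)] obtain k where k: "0 < k" "k \<le> e" "int e dvd lucas_u s k"
      by auto
    show ?thesis
    proof (cases "p dvd e")
      case True
      \<comment> \<open>\<open>p\<close> and \<open>e\<close> are not coprime here. The extra factor
        \<open>p\<close> comes from \<open>u (k * p) / u k\<close>, which is \<open>p\<close> or
        \<open>- p\<close> modulo \<open>p\<close>.\<close>
      then have pk: "int p dvd lucas_u s k" using k by (meson dvd_trans of_nat_dvd_iff)
      then have "int p ^ 1 dvd (lucas_v s k)\<^sup>2 - 4"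
        unfolding lucas_v_sq by (simp add: power2_eq_square)
      then have "int p dvd lucas_u (lucas_v s k) p"
        using lucas_u_cong_pm[OF cong_pm2_if_sq, of "int p" 1 "lucas_v s k" p] p oe
        by (auto dest: cong_dvd_iff)
      then have "int d dvd lucas_u s (k * p)"
        unfolding lucas_u_mult e using k by (simp add: mult_dvd_mono mult.commute)
      then show ?thesis using k p oe e prime_gt_0_nat[of p]
        by (intro exI[of _ "k * p"]) auto
    next
      case False
      obtain l where l: "0 < l" "l \<le> p" "int p dvd lucas_u s l"
        using exists_dvd_lucas_u_prime[OF p(1) oe(1)] by blast
      have "int p dvd lucas_u s (k * l)" "int e dvd lucas_u s (k * l)"
        using k l lucas_u_mult[of s k l] lucas_u_mult[of s l k]
        by (metis dvd_mult2 mult.commute)+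
      moreover have "coprime (int p) (int e)"
        using False p by (simp add: prime_imp_coprime)
      ultimately have "int d dvd lucas_u s (k * l)"
        unfolding e by (simp add: divides_mult)
      then show ?thesis using k l e
        by (intro exI[of _ "k * l"]) (auto simp: mult.commute[of p] intro!: mult_le_mono)
    qed
  qed
qed

section \<open>The valuation \<open>nu\<close> and the final formula\<close>

lemma nu_cong:
  assumes "\<And>p. p \<in> prime_factors d \<Longrightarrow> multiplicity p a = multiplicity p b"
  shows "nu d (of_int a) = nu d (of_int b)"
  unfolding nu_def padic_val_def using assms
  by (intro arg_cong[where f = Min] image_cong) auto

lemma nu_eq_0:
  assumes "d \<ge> 2" "\<not> d dvd N"
  shows "nu d (of_int N) = 0"
proof -
  have "N \<noteq> 0" using assms by auto
  with assms dvd_power_iff_le_nu[of d N 0] dvd_power_iff_le_nu[of d N 1] show ?thesis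
    by simp
qed

theorem theorem14:
  fixes s d :: int
  assumes "s \<ge> 2" and "d \<ge> 3" and "odd d"
  shows "\<exists>s' d' :: int. s' \<noteq> 0 \<and> 1 \<le> d' \<and> d' \<le> d \<and>
    (\<forall>n :: nat. n > 0 \<longrightarrow>
       nu d (of_int (gen_fib s (-1) n)) =
         delta_mult d' (int n) * nu d (of_int s' * of_nat n / of_int d'))"
proof -
  define Q where "Q k \<longleftrightarrow> 0 < k \<and> d dvd lucas_u s k" for k
  define D where "D = (LEAST k. Q k)"
  obtain k where k: "Q k" "k \<le> nat d"
    using exists_dvd_lucas_u[of "nat d" s] assms by (auto simp: Q_def even_nat_iff)
  then have D: "0 < D" "d dvd lucas_u s D" and Dle: "D \<le> nat d"
    using LeastI[of Q k] Least_le[of Q k] by (auto simp: D_def Q_def)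
  have iff: "d dvd lucas_u s n \<longleftrightarrow> D dvd n" for n
  proof -
    \<comment> \<open>The remainder is below the least index \<open>D\<close>, so it can only be 0
      if \<open>d\<close> divides there.\<close>
    have "\<not> Q (n mod D)"
      using not_less_Least[of "n mod D" Q] D by (simp add: D_def)
    then have "d dvd lucas_u s (n mod D) \<longleftrightarrow> n mod D = 0"
      by (auto simp: Q_def)
    then show ?thesis using dvd_lucas_u_mod_iff[OF D(2), of n] by (simp add: dvd_eq_mod_eq_0)
  qed
  have nz: "lucas_u s D \<noteq> 0" using lucas_u_pos[OF assms(1) D(1)] by simp
  have "nu d (of_int (lucas_u s n)) =
         delta_mult (int D) (int n) * nu d (of_int (lucas_u s D) * of_nat n / of_int (int D))"
    if "n > 0" for n
  proof (cases "D dvd n")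
    case False
    then show ?thesis
      using nu_eq_0[of d "lucas_u s n"] assms iff[of n] by (simp add: delta_mult_def)
  next
    case True
    then obtain m where m: "n = D * m" by (elim dvdE)
    with that have "m > 0" by simp
    \<comment> \<open>Here \<open>s' n / d'\<close> is \<open>u D * m\<close>. The minimum in
      \<open>nu\<close> involves only primes dividing \<open>d\<close>, and these divide
      \<open>u D\<close>.\<close>
    have "nu d (of_int (lucas_u s (D * m))) = nu d (of_int (lucas_u s D * int m))"
    proof (rule nu_cong)
      fix p assume "p \<in> prime_factors d"
      then have "prime p" "p dvd d" by auto
      moreover from this have "odd p" "p dvd lucas_u s D"
        using assms(3) D(2) by (auto intro: dvd_trans)
      ultimately show "multiplicity p (lucas_u s (D * m)) = multiplicity p (lucas_u s D * int m)"
        using nz \<open>m > 0\<close> by (intro multiplicity_lucas_u_mult) auto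
    qed
    with m D(1) show ?thesis by (simp add: delta_mult_def)
  qed
  then show ?thesis
    using nz D Dle assms by (intro exI[of _ "lucas_u s D"] exI[of _ "int D"]) auto
qed

end
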